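(* Let $\lambda/\mu$ be a skew shape. Then the Ehrhart polynomial of the lattice path matroid $M(\lambda/\mu)$ can be expressed as $$\mathcal{E}(M(\lambda/\mu);t)=\sum_{x\in M(\lambda/\mu)}\Omega(\mathsf{sh}(x);t).$$
   Context: For a finite poset $P$, the order polynomial $\Omega(P;t)$ is the unique polynomial in $\mathbb{Q}[t]$ such that for every positive integer $t$, $\Omega(P;t)=\#\{f:P\to\{1,\dots,t\}: f(x)\le f(y)\text{ whenever }x\preceq y\}$; in particular $\Omega(\emptyset;t)=1$. Let $\lambda/\mu$ be a skew shape, drawn in English notation (rows numbered from top to bottom, so North means smaller row index and West means smaller column index). Let $L$ and $U$ be its southeast and northwest boundary lattice paths, viewed as non-crossing paths with unit North and East steps from $(0,0)$ to $(m,r)$. The lattice path matroid $M(\lambda/\mu)=M[L,U]$ is the matroid on $\{1,\dots,m+r\}$ whose bases are the sets of positions of the North steps of lattice paths from $(0,0)$ to $(m,r)$ lying weakly between $L$ and $U$. Writing $x\in M(\lambda/\mu)$ means that $x$ is such a lattice path (equivalently, a basis). $\mathcal{E}(M(\lambda/\mu);t)$ is the Ehrhart polynomial of the base polytope, i.e. of the convex hull of the indicator vectors in $\mathbb{R}^{m+r}$ of the bases: for each positive integer $t$ it counts the lattice points of the $t$-th dilate of that polytope. The cells of $\lambda/\mu$ form a poset in which a cell $c_1$ covers a cell $c_2$ if and only if $c_1$ is the cell directly West or directly North of $c_2$. For a lattice path $x\in M(\lambda/\mu)$, let $I(x)$ be the set of cells of $\lambda/\mu$ lying below (southeast of) $x$;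 it is an order ideal of this poset. The shade $\mathsf{sh}(x)$ is the set of cells $c\in I(x)$ such that the cell diagonally northwest of $c$ (one row up and one column to the left) does not belong to $I(x)$, with the partial order induced from the poset of cells of $\lambda/\mu$. *)

theory Defs
  imports
    "HOL-Analysis.Analysis"
    "HOL-Analysis.Finite_Function_Topology"
    "HOL-Computational_Algebra.Polynomial"
begin

section \<open>Order polynomials\<close>

text \<open>A finite poset is a carrier \<open>P\<close> with its order relation \<open>le\<close>: \<open>(x, y) \<in> le\<close> means \<open>x \<preceq> y\<close>.\<close>

definition order_polynomial :: "'a set \<Rightarrow> 'a rel \<Rightarrow> rat poly" where
  "order_polynomial P le = (THE p. \<forall>t::nat. t > 0 \<longrightarrow>
     poly p (of_nat t) =
       of_nat (card {f \<in> P \<rightarrow>\<^sub>E {1..t}. \<forall>x\<in>P. \<forall>y\<in>P. (x, y) \<in> le \<longrightarrow> f x \<le> f y}))"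

section \<open>Skew shapes and lattice paths\<close>

text \<open>
  A partition is the list of its row lengths, top row first. Both partitions of a skew shape
  are padded with zero rows to the common length \<open>r\<close>, and \<open>m\<close> is the width of the bounding box
  (equal to the first row length when the box is the smallest possible).
  Rows, columns and cells are numbered from 0.
\<close>

definition skew_shape :: "nat \<Rightarrow> nat list \<Rightarrow> nat list \<Rightarrow> bool" where
  "skew_shape m lam mu \<longleftrightarrow>
     length mu = length lam \<and> sorted_wrt (\<ge>) lam \<and> sorted_wrt (\<ge>) mu \<and>
     (\<forall>i < length lam. mu ! i \<le> lam ! i \<and> lam ! i \<le> m)"

definition cells :: "nat list \<Rightarrow> nat list \<Rightarrow> (nat \<times> nat) set" where
  "cells lam mu = {(i, j). i < length lam \<and> mu ! i \<le> j \<and> j < lam ! i}"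

text \<open>Pairs \<open>(c\<^sub>2, c\<^sub>1)\<close> such that \<open>c\<^sub>1\<close> covers \<open>c\<^sub>2\<close>: it is directly West or directly North of \<open>c\<^sub>2\<close>.\<close>

definition cell_covers :: "nat list \<Rightarrow> nat list \<Rightarrow> (nat \<times> nat) rel" where
  "cell_covers lam mu =
     Restr ({((i, Suc j), (i, j)) | i j. True} \<union> {((Suc i, j), (i, j)) | i j. True}) (cells lam mu)"

definition cell_order :: "nat list \<Rightarrow> nat list \<Rightarrow> (nat \<times> nat) rel" where
  "cell_order lam mu = Restr ((cell_covers lam mu)\<^sup>*) (cells lam mu)"

datatype step = North | East

text \<open>
  The southeast boundary of the partition \<open>p\<close> inside its box of width \<open>m\<close>, traversed from the
  southwest corner to the northeast corner. The recursion peels off the top row \<open>a\<close>: the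
  boundary of the rows below it, stopped at column \<open>a\<close>, then the step along the right end of
  the top row, then East to the corner.
\<close>

fun boundary_path :: "nat \<Rightarrow> nat list \<Rightarrow> step list" where
  "boundary_path m [] = replicate m East"
| "boundary_path m (a # p) = boundary_path a p @ [North] @ replicate (m - a) East"

text \<open>Paths with a common origin are compared antidiagonal by antidiagonal.\<close>

definition weakly_below :: "step list \<Rightarrow> step list \<Rightarrow> bool" where
  "weakly_below x y \<longleftrightarrow> (\<forall>k. count_list (take k x) North \<le> count_list (take k y) North)"

text \<open>For a skew shape, \<open>L\<close> is the boundary path of \<open>lam\<close> and \<open>U\<close> that of \<open>mu\<close>.\<close>

definition lattice_paths :: "nat \<Rightarrow> nat list \<Rightarrow> nat list \<Rightarrow> step list set" where
  "lattice_paths m lam mu =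
     {x. count_list x North = length lam \<and> count_list x East = m \<and>
         weakly_below (boundary_path m lam) x \<and> weakly_below x (boundary_path m mu)}"

section \<open>Ideals and shades of lattice paths\<close>

text \<open>
  The North step of \<open>x\<close> crossing row \<open>i\<close> is the one followed by exactly \<open>i\<close> further North steps,
  as rows are numbered from the top. The cell \<open>(i, j)\<close>, whose left side is at abscissa \<open>j\<close>,
  lies southeast of \<open>x\<close> when that step is weakly to the left of the cell.
\<close>

definition southeast_of :: "step list \<Rightarrow> nat \<times> nat \<Rightarrow> bool" where
  "southeast_of x = (\<lambda>(i, j). \<exists>k < length x. x ! k = North \<and>
     count_list (drop (Suc k) x) North = i \<and> count_list (take k x) East \<le> j)"

definition path_ideal :: "nat list \<Rightarrow> nat list \<Rightarrow> step list \<Rightarrow> (nat \<times> nat) set" where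
  "path_ideal lam mu x = {c \<in> cells lam mu. southeast_of x c}"

text \<open>Cells in row 0 or column 0 have no northwest neighbour, so belonging to the ideal suffices.\<close>

definition shade :: "nat list \<Rightarrow> nat list \<Rightarrow> step list \<Rightarrow> (nat \<times> nat) set" where
  "shade lam mu x = {(i, j). (i, j) \<in> path_ideal lam mu x \<and>
     \<not> (i > 0 \<and> j > 0 \<and> (i - 1, j - 1) \<in> path_ideal lam mu x)}"

definition shade_order :: "nat list \<Rightarrow> nat list \<Rightarrow> step list \<Rightarrow> (nat \<times> nat) rel" where
  "shade_order lam mu x = Restr (cell_order lam mu) (shade lam mu x)"

section \<open>Lattice path matroids and Ehrhart polynomials\<close>

text \<open>A matroid is given by its ground set and its set of bases.\<close>

type_synonym 'a matroid = "'a set \<times> 'a set set"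

definition north_positions :: "step list \<Rightarrow> nat set" where
  "north_positions x = {Suc k | k. k < length x \<and> x ! k = North}"

definition lattice_path_matroid :: "nat \<Rightarrow> nat list \<Rightarrow> nat list \<Rightarrow> nat matroid" where
  "lattice_path_matroid m lam mu =
     ({1..m + length lam}, north_positions ` lattice_paths m lam mu)"

text \<open>
  As the ground set varies in size, \<open>\<real>\<^sup>E\<close> is represented by the finitely supported functions
  vanishing outside \<open>E\<close>, inside the real vector space of all finitely supported functions.
  The dilates of a base polytope consist of such functions.
\<close>

definition indicator_vector :: "'a set \<Rightarrow> ('a \<Rightarrow>\<^sub>0 real)" where
  "indicator_vector B = (\<Sum>b\<in>B. Poly_Mapping.single b 1)"

definition base_polytope :: "'a matroid \<Rightarrow> ('a \<Rightarrow>\<^sub>0 real) set" where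
  "base_polytope M = convex hull (indicator_vector ` snd M)"

definition lattice_points :: "('a \<Rightarrow>\<^sub>0 real) set \<Rightarrow> ('a \<Rightarrow>\<^sub>0 real) set" where
  "lattice_points Q = {v \<in> Q. \<forall>i. Poly_Mapping.lookup v i \<in> \<int>}"

definition ehrhart_polynomial :: "('a \<Rightarrow>\<^sub>0 real) set \<Rightarrow> rat poly" where
  "ehrhart_polynomial Q = (THE p. \<forall>t::nat. t > 0 \<longrightarrow>
     poly p (of_nat t) = of_nat (card (lattice_points ((\<lambda>v. real t *\<^sub>R v) ` Q))))"

definition matroid_ehrhart :: "'a matroid \<Rightarrow> rat poly" where
  "matroid_ehrhart M = ehrhart_polynomial (base_polytope M)"

end

theory Submission
  imports Defs
begin

text \<open>
  A lattice path is encoded by its height function, where \<open>height x k\<close> counts the North steps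
  among the first \<open>k\<close>. Partial sums turn an integer vector into a sequence \<open>S\<close>, and the lattice
  points of the \<open>t\<close>-fold dilate of the base polytope become the integer sequences with increments
  in \<open>{0..t}\<close> that run between \<open>t\<close> times the height of the lower boundary and \<open>t\<close> times that of
  the upper one (\<open>bij_betw_lattice_points_heights\<close>). These inequalities hold at the vertices. In
  the other direction Hermite's identity \<open>S k = (\<Sum>j<t. (S k + j) div t)\<close> writes \<open>S\<close> as a sum of
  height functions of \<open>t\<close> lattice paths.

  Rounding \<open>S k / t\<close> up gives the height function of one lattice path \<open>x\<close>, the largest of these
  \<open>t\<close> paths. Once \<open>x\<close> is fixed, \<open>S\<close> is determined by the deficits \<open>d k = t * height x k - S k\<close>,
  which lie between \<open>0\<close> and \<open>t - 1\<close>. The bounds on the increments of \<open>S\<close> say that \<open>d\<close> weakly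
  increases along the North steps of \<open>x\<close> and weakly decreases along its East steps, and the lower
  boundary forces \<open>d k = 0\<close> where \<open>x\<close> touches it (\<open>bij_betw_shade_labels_heights\<close>).

  A cell of the ideal belongs to the shade exactly when its northwest corner is a vertex of \<open>x\<close>
  (\<open>mem_shade_iff\<close>), so the shade is a ribbon of cells indexed by the vertices of \<open>x\<close> that lie
  strictly above the lower boundary. A North step of \<open>x\<close> leads to the cell covering the present
  one, an East step to a cell covered by it. Hence \<open>d + 1\<close> is an order-preserving map
  from the shade to \<open>{1..t}\<close>, and every such map arises once
  (\<open>bij_betw_order_preserving_maps_shade_labels\<close>).

  Summing over \<open>x\<close>, both sides agree at every positive integer \<open>t\<close>. The counting function of a
  finite poset is a polynomial (\<open>order_preserving_maps_polynomial\<close>), so the right-hand side is a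
  polynomial with the values required of the Ehrhart polynomial, and there is only one such.
\<close>

section \<open>Order polynomials exist\<close>

definition order_preserving_maps :: "'a set \<Rightarrow> 'a rel \<Rightarrow> nat \<Rightarrow> ('a \<Rightarrow> nat) set" where
  "order_preserving_maps P le t =
     {f \<in> P \<rightarrow>\<^sub>E {1..t}. \<forall>x\<in>P. \<forall>y\<in>P. (x, y) \<in> le \<longrightarrow> f x \<le> f y}"

lemma finite_order_preserving_maps: "finite P \<Longrightarrow> finite (order_preserving_maps P le t)"
  unfolding order_preserving_maps_def by (rule finite_subset[OF _ finite_PiE[of P "\<lambda>_. {1..t}"]]) auto

text \<open>By the binomial theorem \<open>(x + 1)^(k + 1) - x^(k + 1)\<close> is \<open>(k + 1) x^k\<close> plus lower powers
  of \<open>x\<close>, which have antidifferences by induction.\<close>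

lemma power_has_antidifference:
  "\<exists>q :: rat poly. \<forall>x. poly q (x + 1) - poly q x = x ^ k"
proof (induction k rule: less_induct)
  case (less k)
  then have "\<forall>i. \<exists>q :: rat poly. i < k \<longrightarrow> (\<forall>x. poly q (x + 1) - poly q x = x ^ i)"
    by auto
  then obtain q :: "nat \<Rightarrow> rat poly"
    where q: "\<And>i x. i < k \<Longrightarrow> poly (q i) (x + 1) - poly (q i) x = x ^ i"
    by metis
  define g where "g = monom 1 (Suc k) - (\<Sum>i<k. smult (of_nat (Suc k choose i)) (q i))"
  have "poly g (x + 1) - poly g x = of_nat (Suc k) * x ^ k" for x
  proof -
    have "(x + 1) ^ Suc k = (\<Sum>i\<le>Suc k. of_nat (Suc k choose i) * x ^ i)"
      by (subst binomial_ring) simp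
    also have "\<dots> = (\<Sum>i<k. of_nat (Suc k choose i) * x ^ i) + of_nat (Suc k) * x ^ k + x ^ Suc k"
      by (simp flip: lessThan_Suc_atMost)
    also have "(\<Sum>i<k. of_nat (Suc k choose i) * x ^ i) =
        (\<Sum>i<k. of_nat (Suc k choose i) * (poly (q i) (x + 1) - poly (q i) x))"
      by (intro sum.cong) (auto simp: q)
    finally show ?thesis
      by (simp add: g_def poly_monom poly_sum sum_subtractf right_diff_distrib del: power_Suc)
  qed
  then have "\<forall>x. poly (smult (1 / of_nat (Suc k)) g) (x + 1) -
      poly (smult (1 / of_nat (Suc k)) g) x = x ^ k"
    by (simp flip: right_diff_distrib diff_divide_distrib del: of_nat_Suc)
  then show ?case by blast
qed

lemma poly_has_antidifference:
  fixes p :: "rat poly"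
  shows "\<exists>q :: rat poly. \<forall>x. poly q (x + 1) - poly q x = poly p x"
proof -
  obtain q :: "nat \<Rightarrow> rat poly" where q: "\<And>k x. poly (q k) (x + 1) - poly (q k) x = x ^ k"
    using power_has_antidifference by metis
  have "poly (\<Sum>i\<le>degree p. smult (coeff p i) (q i)) (x + 1) -
      poly (\<Sum>i\<le>degree p. smult (coeff p i) (q i)) x = poly p x" for x
    by (simp add: poly_sum q poly_altdef[of p] flip: sum_subtractf right_diff_distrib)
  then show ?thesis by blast
qed

text \<open>An order-preserving map to \<open>{1..t + 1}\<close> is the upper set \<open>F\<close> on which it takes the value
  \<open>t + 1\<close>, together with an order-preserving map from the rest to \<open>{1..t}\<close>.\<close>

lemma card_order_preserving_maps_Suc:
  assumes "finite P"
  shows "card (order_preserving_maps P le (Suc t)) =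
    (\<Sum>F | F \<subseteq> P \<and> (\<forall>x\<in>F. \<forall>y\<in>P. (x, y) \<in> le \<longrightarrow> y \<in> F).
       card (order_preserving_maps (P - F) le t))"
proof -
  let ?U = "{F. F \<subseteq> P \<and> (\<forall>x\<in>F. \<forall>y\<in>P. (x, y) \<in> le \<longrightarrow> y \<in> F)}"
  define top where "top f = {x \<in> P. f x = Suc t}" for f
  let ?split = "\<lambda>f. (top f, restrict f (P - top f))"
  let ?glue = "\<lambda>(F, g). restrict (\<lambda>x. if x \<in> F then Suc t else g x) P"
  have "bij_betw ?split (order_preserving_maps P le (Suc t))
      (SIGMA F:?U. order_preserving_maps (P - F) le t)"
  proof (rule bij_betwI[where g = ?glue])
    show "?split \<in> order_preserving_maps P le (Suc t) \<rightarrow>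
        (SIGMA F:?U. order_preserving_maps (P - F) le t)"
    proof
      fix f assume f: "f \<in> order_preserving_maps P le (Suc t)"
      then have range: "\<And>x. x \<in> P \<Longrightarrow> 1 \<le> f x \<and> f x \<le> Suc t"
        and mono: "\<And>x y. x \<in> P \<Longrightarrow> y \<in> P \<Longrightarrow> (x, y) \<in> le \<Longrightarrow> f x \<le> f y"
        by (auto simp: order_preserving_maps_def PiE_iff)
      have "top f \<in> ?U"
        using mono range by (fastforce simp: top_def)
      moreover have "f x \<le> t" if "x \<in> P" "f x \<noteq> Suc t" for x
        using range[OF that(1)] that(2) by simp
      ultimately show "?split f \<in> (SIGMA F:?U. order_preserving_maps (P - F) le t)"
        using range mono by (auto simp: order_preserving_maps_def top_def)
    qed
    show "?glue \<in> (SIGMA F:?U. order_preserving_maps (P - F) le t) \<rightarrow>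
        order_preserving_maps P le (Suc t)"
    proof (clarsimp, goal_cases)
      case (1 F g)
      then have "\<And>x. x \<in> P \<Longrightarrow> x \<notin> F \<Longrightarrow> 1 \<le> g x \<and> g x \<le> t"
        by (auto simp: order_preserving_maps_def PiE_iff)
      then show ?case
        using 1 by (force simp: order_preserving_maps_def)
    qed
    show "?glue (?split f) = f" if "f \<in> order_preserving_maps P le (Suc t)" for f
      using that by (auto simp: order_preserving_maps_def top_def PiE_iff extensional_def fun_eq_iff)
    show "?split (?glue z) = z" if "z \<in> (SIGMA F:?U. order_preserving_maps (P - F) le t)" for z
    proof -
      obtain F g where z: "z = (F, g)" "F \<subseteq> P" "g \<in> order_preserving_maps (P - F) le t"
        using \<open>z \<in> _\<close> by auto
      then have "g x \<noteq> Suc t" if "x \<in> P" "x \<notin> F" for x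
        using that by (force simp: order_preserving_maps_def PiE_iff)
      then have "top (?glue z) = F"
        using z(1,2) by (auto simp: top_def)
      then show ?thesis
        using z by (auto simp: order_preserving_maps_def PiE_iff extensional_def fun_eq_iff)
    qed
  qed
  then have "card (order_preserving_maps P le (Suc t)) =
      card (SIGMA F:?U. order_preserving_maps (P - F) le t)"
    by (rule bij_betw_same_card)
  also have "\<dots> = (\<Sum>F\<in>?U. card (order_preserving_maps (P - F) le t))"
    using assms by (subst card_SigmaI) (auto intro: finite_order_preserving_maps)
  finally show ?thesis .
qed

text \<open>The term \<open>F = {}\<close> of the recursion above counts the maps to \<open>{1..t}\<close>; so the difference of
  the counting function is a sum of counting functions of smaller posets, hence a polynomial by
  induction.\<close>

lemma order_preserving_maps_polynomial:
  assumes "finite P"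
  shows "\<exists>p :: rat poly. \<forall>t. poly p (of_nat t) = of_nat (card (order_preserving_maps P le t))"
  using assms
proof (induction P rule: finite_psubset_induct)
  case (psubset P)
  let ?N = "\<lambda>F t. card (order_preserving_maps (P - F) le t)"
  let ?U = "{F. F \<subseteq> P \<and> (\<forall>x\<in>F. \<forall>y\<in>P. (x, y) \<in> le \<longrightarrow> y \<in> F)}"
  have "finite ?U"
    using psubset.hyps by simp
  have "\<forall>F\<in>?U - {{}}. \<exists>p :: rat poly. \<forall>t. poly p (of_nat t) = of_nat (?N F t)"
  proof
    fix F assume "F \<in> ?U - {{}}"
    then have "P - F \<subset> P" by auto
    then show "\<exists>p :: rat poly. \<forall>t. poly p (of_nat t) = of_nat (?N F t)"
      using psubset.IH by blast
  qed
  from bchoice[OF this] obtain p :: "'a set \<Rightarrow> rat poly"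
    where p: "\<And>F t. F \<in> ?U - {{}} \<Longrightarrow> poly (p F) (of_nat t) = of_nat (?N F t)"
    by blast
  obtain q :: "rat poly"
    where q: "\<And>x. poly q (x + 1) - poly q x = poly (\<Sum>F\<in>?U - {{}}. p F) x"
    using poly_has_antidifference[of "\<Sum>F\<in>?U - {{}}. p F"] by blast
  have step: "of_nat (?N {} (Suc t)) =
      of_nat (?N {} t) + (poly q (of_nat (Suc t)) - poly q (of_nat t))" for t
  proof -
    have "?N {} (Suc t) = (\<Sum>F\<in>?U. ?N F t)"
      using card_order_preserving_maps_Suc[OF psubset.hyps] by simp
    also have "\<dots> = ?N {} t + (\<Sum>F\<in>?U - {{}}. ?N F t)"
      by (rule sum.remove) (use \<open>finite ?U\<close> in auto)
    finally have "of_nat (?N {} (Suc t)) = of_nat (?N {} t) + (\<Sum>F\<in>?U - {{}}. of_nat (?N F t) :: rat)"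
      by simp
    also have "(\<Sum>F\<in>?U - {{}}. of_nat (?N F t)) = poly (\<Sum>F\<in>?U - {{}}. p F) (of_nat t)"
      unfolding poly_sum by (rule sum.cong) (use p in auto)
    also have "\<dots> = poly q (of_nat (Suc t)) - poly q (of_nat t)"
      using q[of "of_nat t"] by (simp add: add.commute)
    finally show ?thesis .
  qed
  have "poly (q + [:of_nat (?N {} 0) - poly q 0:]) (of_nat t) = of_nat (?N {} t)" for t
    by (induction t) (use step in auto)
  then show ?case by (metis Diff_empty)
qed

lemma rat_poly_eqI_pos_nat:
  fixes p q :: "rat poly"
  assumes "\<And>t :: nat. t > 0 \<Longrightarrow> poly p (of_nat t) = poly q (of_nat t)"
  shows "p = q"
proof (rule ccontr)
  assume "p \<noteq> q"
  then have "finite {x. poly (p - q) x = 0}"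
    by (intro poly_roots_finite) simp
  moreover have "of_nat ` {0::nat<..} \<subseteq> {x. poly (p - q) x = 0}"
    using assms by auto
  ultimately have "finite (of_nat ` {0::nat<..} :: rat set)"
    by (rule finite_subset[rotated])
  then have "finite {0::nat<..}"
    by (rule finite_imageD) (simp add: inj_on_def)
  then show False
    using infinite_Ioi by blast
qed

lemma poly_order_polynomial:
  assumes "finite P" "t > 0"
  shows "poly (order_polynomial P le) (of_nat t) = of_nat (card (order_preserving_maps P le t))"
proof -
  let ?is = "\<lambda>p :: rat poly. \<forall>t::nat. t > 0 \<longrightarrow>
      poly p (of_nat t) = of_nat (card (order_preserving_maps P le t))"
  have "\<exists>!p. ?is p"
  proof (rule ex_ex1I)
    show "\<exists>p. ?is p"
      using order_preserving_maps_polynomial[OF assms(1), of le] by blast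
    show "p = q" if "?is p" "?is q" for p q
      using that by (intro rat_poly_eqI_pos_nat) simp
  qed
  then have "?is (THE p. ?is p)"
    by (rule theI')
  then show ?thesis
    using assms(2) by (simp add: order_polynomial_def order_preserving_maps_def)
qed

section \<open>Heights of lattice paths\<close>

definition height :: "step list \<Rightarrow> nat \<Rightarrow> nat" where
  "height x k = count_list (take k x) North"

lemma height_0 [simp]: "height x 0 = 0"
  by (simp add: height_def)

lemma height_Suc:
  "height x (Suc k) = height x k + (if k < length x \<and> x ! k = North then 1 else 0)"
  by (cases "k < length x") (simp_all add: height_def take_Suc_conv_app_nth)

lemma height_mono: "k \<le> l \<Longrightarrow> height x k \<le> height x l"
  by (rule lift_Suc_mono_le) (simp_all add: height_Suc)

lemma height_add_le: "height x (k + d) \<le> height x k + d"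
  by (induction d) (simp_all add: height_Suc)

lemma height_le: "height x k \<le> k"
  using height_add_le[of x 0 k] by simp

lemma height_ge_length: "length x \<le> k \<Longrightarrow> height x k = count_list x North"
  by (simp add: height_def)

lemma height_le_count: "height x k \<le> count_list x North"
  using height_mono[of k "k + length x" x] by (simp add: height_ge_length)

lemma count_list_steps: "count_list x North + count_list x East = length x"
proof (induction x)
  case (Cons s x)
  then show ?case by (cases s) auto
qed simp

lemma height_determines_path:
  assumes "length x = length y" "\<And>k. height x k = height y k"
  shows "x = y"
proof (rule nth_equalityI)
  fix k assume "k < length x"
  then have "x ! k = North \<longleftrightarrow> y ! k = North"
    using assms(1) assms(2)[of k] assms(2)[of "Suc k"] by (simp add: height_Suc split: if_splits)
  then show "x ! k = y ! k"
    by (cases "x ! k"; cases "y ! k") auto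
qed (fact assms(1))

lemma length_boundary_path:
  "sorted_wrt (\<ge>) (m # p) \<Longrightarrow> length (boundary_path m p) = m + length p"
  by (induction m p rule: boundary_path.induct) auto

lemma count_list_replicate_East [simp]: "count_list (replicate k East) North = 0"
  by (induction k) auto

lemma count_North_boundary_path: "count_list (boundary_path m p) North = length p"
  by (induction m p rule: boundary_path.induct) auto

text \<open>The North step along the right end of row \<open>i\<close> comes after \<open>p ! i\<close> East steps and the
  \<open>length p - i - 1\<close> North steps of the rows below.\<close>

lemma height_boundary_path:
  assumes "sorted_wrt (\<ge>) (m # p)" "i < length p"
  shows "length p - i \<le> height (boundary_path m p) k \<longleftrightarrow> p ! i + (length p - i) \<le> k"
  using assms
proof (induction m p arbitrary: i rule: boundary_path.induct)
  case (2 m a p)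
  let ?b = "boundary_path a p"
  have len: "length ?b = a + length p"
    using 2 by (intro length_boundary_path) auto
  show ?case
  proof (cases "k \<le> a + length p")
    case True
    then have h: "height (boundary_path m (a # p)) k = height ?b k"
      by (simp add: height_def len)
    show ?thesis
    proof (cases i)
      case 0
      then show ?thesis
        using True h height_le_count[of ?b k] by (simp add: count_North_boundary_path)
    next
      case (Suc j)
      then show ?thesis
        using 2 h by simp
    qed
  next
    case False
    then obtain d where "k = Suc (a + length p) + d"
      by (metis add_Suc le_add_diff_inverse not_less_eq_eq)
    then have "height (boundary_path m (a # p)) k = Suc (length p)"
      by (simp add: height_def len count_North_boundary_path)
    moreover have "p ! j \<le> a" if "j < length p" for j
      using 2 that by simp
    ultimately show ?thesis
      using False 2(3) by (cases i) (fastforce simp: le_diff_conv)+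
  qed
qed simp

text \<open>The North step that crosses row \<open>i\<close> of a path with \<open>r\<close> North steps is the one that reaches
  height \<open>r - i\<close>. It is weakly West of the cell \<open>(i, j)\<close> iff that height is attained no later
  than on the antidiagonal of the northwest corner \<open>(j, r - i)\<close> of the cell.\<close>

lemma southeast_of_iff:
  assumes r: "count_list x North = r" and "i < r"
  shows "southeast_of x (i, j) \<longleftrightarrow> r - i \<le> height x (j + (r - i))"
proof -
  have split: "count_list (take (Suc k) x) North + count_list (drop (Suc k) x) North = r" for k
    using r by (metis append_take_drop_id count_list_append)
  have east: "height x k + count_list (take k x) East = k" if "k < length x" for k
    using count_list_steps[of "take k x"] that by (simp add: height_def)
  show ?thesis
  proof
    assume "southeast_of x (i, j)"
    then obtain k where k: "k < length x" "x ! k = North" "count_list (drop (Suc k) x) North = i"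
        "count_list (take k x) East \<le> j"
      by (auto simp: southeast_of_def)
    then have "height x (Suc k) = r - i"
      using split[of k] by (simp add: height_def)
    moreover have "height x (Suc k) \<le> height x (j + (r - i))"
      using k east[of k] \<open>height x (Suc k) = r - i\<close> by (intro height_mono) (simp add: height_Suc)
    ultimately show "r - i \<le> height x (j + (r - i))" by simp
  next
    assume reached: "r - i \<le> height x (j + (r - i))"
    define K where "K = (LEAST K. r - i \<le> height x K)"
    have K: "r - i \<le> height x K" "K \<le> j + (r - i)" and min: "\<And>k. k < K \<Longrightarrow> height x k < r - i"
      unfolding K_def using reached
      by (auto intro: LeastI Least_le dest: not_less_Least)
    have "K \<noteq> 0"
      using K(1) \<open>i < r\<close> by (intro notI) simp
    then obtain k where k: "K = Suc k"
      using not0_implies_Suc by blast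
    have north: "k < length x" "x ! k = North" "height x (Suc k) = r - i" "height x k + 1 = r - i"
      using K(1) min[of k] k by (auto simp: height_Suc split: if_splits)
    moreover have "count_list (drop (Suc k) x) North = i"
      using split[of k] north(3) \<open>i < r\<close> by (simp add: height_def)
    moreover have "count_list (take k x) East \<le> j"
      using east[OF north(1)] north(4) K(2) k by simp
    ultimately show "southeast_of x (i, j)"
      by (auto simp: southeast_of_def)
  qed
qed

lemma skew_shape_sorted:
  assumes "skew_shape m lam mu"
  shows "sorted_wrt (\<ge>) (m # lam)" "sorted_wrt (\<ge>) (m # mu)"
  using assms by (fastforce simp: skew_shape_def set_conv_nth intro: order.trans)+

lemma lattice_pathsD:
  assumes "x \<in> lattice_paths m lam mu"
  shows "count_list x North = length lam" "length x = m + length lam"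
    "height (boundary_path m lam) k \<le> height x k" "height x k \<le> height (boundary_path m mu) k"
  using assms count_list_steps[of x] by (auto simp: lattice_paths_def weakly_below_def height_def)

lemma finite_lattice_paths: "finite (lattice_paths m lam mu)"
proof (rule finite_subset)
  show "lattice_paths m lam mu \<subseteq> {x. set x \<subseteq> {North, East} \<and> length x = m + length lam}"
    using step.exhaust lattice_pathsD(2) by auto
qed (rule finite_lists_length_eq, simp)

text \<open>The sequences of partial sums of the lattice points in the \<open>t\<close>-fold dilate of the base
  polytope. For \<open>t = 1\<close> they are the height functions of the lattice paths. The conditions fix
  the end points, as the two boundary heights agree at \<open>0\<close> and from the full length on.\<close>

definition dilated_heights :: "nat \<Rightarrow> nat \<Rightarrow> nat list \<Rightarrow> nat list \<Rightarrow> (nat \<Rightarrow> nat) set" where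
  "dilated_heights t m lam mu =
     {S. \<forall>k. S k \<le> S (Suc k) \<and> S (Suc k) \<le> S k + t \<and>
       t * height (boundary_path m lam) k \<le> S k \<and> S k \<le> t * height (boundary_path m mu) k}"

lemma dilated_heights_ge_length:
  assumes "skew_shape m lam mu" "S \<in> dilated_heights t m lam mu" "m + length lam \<le> k"
  shows "S k = t * length lam"
proof -
  have "length mu = length lam"
    using assms(1) by (simp add: skew_shape_def)
  then have "height (boundary_path m lam) k = length lam" "height (boundary_path m mu) k = length lam"
    using assms(3) skew_shape_sorted[OF assms(1)]
    by (simp_all add: height_ge_length length_boundary_path count_North_boundary_path)
  moreover have "t * height (boundary_path m lam) k \<le> S k \<and> S k \<le> t * height (boundary_path m mu) k"
    using assms(2) by (simp add: dilated_heights_def)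
  ultimately show ?thesis by simp
qed

lemma height_in_dilated_heights:
  "x \<in> lattice_paths m lam mu \<Longrightarrow> height x \<in> dilated_heights 1 m lam mu"
  by (simp add: dilated_heights_def lattice_pathsD height_Suc)

lemma path_with_heights:
  assumes sk: "skew_shape m lam mu" and h: "h \<in> dilated_heights 1 m lam mu"
  obtains x where "x \<in> lattice_paths m lam mu" "height x = h"
proof
  let ?n = "m + length lam"
  define x where "x = map (\<lambda>k. if h k < h (Suc k) then North else East) [0..<?n]"
  have step: "h k \<le> h (Suc k)" "h (Suc k) \<le> h k + 1" for k
    using h by (auto simp: dilated_heights_def)
  have [simp]: "h k = length lam" if "?n \<le> k" for k
    using dilated_heights_ge_length[OF sk h that] by simp
  have "height x k = h k" for k
  proof (induction k)
    case 0
    show ?case using h by (auto simp: dilated_heights_def dest: spec[of _ 0])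
  next
    case (Suc k)
    then show ?case
      using step[of k] by (cases "k < ?n") (auto simp: height_Suc x_def)
  qed
  then show "height x = h" by auto
  have "length x = ?n" by (simp add: x_def)
  moreover have "count_list x North = length lam"
    using height_ge_length[of x ?n] \<open>height x = h\<close> \<open>length x = ?n\<close> by simp
  moreover have "count_list x East = m"
    using calculation count_list_steps[of x] by simp
  ultimately show "x \<in> lattice_paths m lam mu"
    using h \<open>height x = h\<close>
    by (simp add: lattice_paths_def weakly_below_def dilated_heights_def flip: height_def)
qed

section \<open>Shades\<close>

text \<open>The northwest neighbour of a cell lies on the same antidiagonal, one height unit up.
  If that neighbour is southeast of \<open>x\<close>, it is in the skew shape, because \<open>x\<close> is below the boundary
  of \<open>mu\<close>. So a cell of the ideal is in the shade iff \<open>x\<close> runs through its northwest corner. The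
  last condition says that the cell lies in \<open>lam\<close>.\<close>

lemma mem_shade_iff:
  assumes sk: "skew_shape m lam mu" and x: "x \<in> lattice_paths m lam mu"
  shows "(i, j) \<in> shade lam mu x \<longleftrightarrow> i < length lam \<and>
    height x (j + (length lam - i)) = length lam - i \<and>
    height (boundary_path m lam) (j + (length lam - i)) < length lam - i"
proof -
  let ?r = "length lam" and ?L = "height (boundary_path m lam)" and ?U = "height (boundary_path m mu)"
  have len: "length mu = ?r"
    using sk by (simp add: skew_shape_def)
  have mem_cells: "(i, j) \<in> cells lam mu \<longleftrightarrow> i < ?r \<and> ?r - i \<le> ?U (j + (?r - i)) \<and> ?L (j + (?r - i)) < ?r - i"
    for i j
  proof (cases "i < ?r")
    case True
    then show ?thesis
      using height_boundary_path[OF skew_shape_sorted(1)[OF sk], of i "j + (?r - i)"]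
        height_boundary_path[OF skew_shape_sorted(2)[OF sk], of i "j + (?r - i)"] len
      by (auto simp: cells_def not_le[symmetric])
  qed (simp add: cells_def)
  have mem_ideal: "(i, j) \<in> path_ideal lam mu x \<longleftrightarrow>
      i < ?r \<and> ?r - i \<le> height x (j + (?r - i)) \<and> ?L (j + (?r - i)) < ?r - i" for i j
    using mem_cells[of i j] southeast_of_iff[OF lattice_pathsD(1)[OF x], of i j]
      lattice_pathsD(4)[OF x, of "j + (?r - i)"]
    by (auto simp: path_ideal_def)
  show ?thesis
  proof (cases "(i, j) \<in> path_ideal lam mu x")
    case True
    let ?k = "j + (?r - i)"
    have True': "i < ?r" "?r - i \<le> height x ?k" "?L ?k < ?r - i"
      using True by (auto simp: mem_ideal)
    have nw: "(i - 1, j - 1) \<in> path_ideal lam mu x \<longleftrightarrow> Suc (?r - i) \<le> height x ?k" if "i > 0" "j > 0"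
    proof -
      have same_diagonal: "j - 1 + (?r - (i - 1)) = ?k" and "?r - (i - 1) = Suc (?r - i)"
        using that True'(1) by auto
      then show ?thesis
        unfolding mem_ideal same_diagonal using True' by linarith
    qed
    have "i > 0 \<and> j > 0" if "Suc (?r - i) \<le> height x ?k"
      using that height_le[of x ?k] height_le_count[of x ?k] lattice_pathsD(1)[OF x] True'(1) by auto
    then have "(i, j) \<in> shade lam mu x \<longleftrightarrow> \<not> Suc (?r - i) \<le> height x ?k"
      using nw True by (auto simp: shade_def)
    also have "\<dots> \<longleftrightarrow> height x ?k = ?r - i"
      using True'(2) by auto
    finally show ?thesis
      using True' by simp
  qed (auto simp: shade_def mem_ideal)
qed

definition corner_cell :: "nat list \<Rightarrow> step list \<Rightarrow> nat \<Rightarrow> nat \<times> nat" where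
  "corner_cell lam x k = (length lam - height x k, k - height x k)"

definition shade_indices :: "nat \<Rightarrow> nat list \<Rightarrow> step list \<Rightarrow> nat set" where
  "shade_indices m lam x = {k. height (boundary_path m lam) k < height x k}"

lemma shade_eq_corner_cells:
  assumes sk: "skew_shape m lam mu" and x: "x \<in> lattice_paths m lam mu"
  shows "shade lam mu x = corner_cell lam x ` shade_indices m lam x"
proof (intro set_eqI iffI)
  fix c assume "c \<in> shade lam mu x"
  moreover obtain i j where c: "c = (i, j)" by fastforce
  moreover define k where "k = j + (length lam - i)"
  ultimately have "i < length lam" "height x k = length lam - i"
      "height (boundary_path m lam) k < length lam - i"
    using mem_shade_iff[OF sk x, of i j] by auto
  then have "c = corner_cell lam x k" "k \<in> shade_indices m lam x"
    by (auto simp: corner_cell_def shade_indices_def c k_def)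
  then show "c \<in> corner_cell lam x ` shade_indices m lam x" by blast
next
  fix c assume "c \<in> corner_cell lam x ` shade_indices m lam x"
  then obtain k where k: "height (boundary_path m lam) k < height x k" "c = corner_cell lam x k"
    by (auto simp: shade_indices_def)
  then show "c \<in> shade lam mu x"
    using height_le[of x k] height_le_count[of x k] lattice_pathsD(1)[OF x]
    by (simp add: corner_cell_def mem_shade_iff[OF sk x])
qed

lemma inj_corner_cell:
  assumes "x \<in> lattice_paths m lam mu"
  shows "inj (corner_cell lam x)"
proof (rule injI)
  fix k l assume "corner_cell lam x k = corner_cell lam x l"
  then show "k = l"
    using height_le[of x k] height_le[of x l] height_le_count[of x k] height_le_count[of x l]
      lattice_pathsD(1)[OF assms] by (auto simp: corner_cell_def)
qed

lemma finite_shade_indices: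
  assumes "skew_shape m lam mu" "x \<in> lattice_paths m lam mu"
  shows "finite (shade_indices m lam x)"
proof (rule finite_subset)
  show "shade_indices m lam x \<subseteq> {..<m + length lam}"
  proof
    fix k assume k: "k \<in> shade_indices m lam x"
    have "height (boundary_path m lam) k = height x k" if "m + length lam \<le> k"
      using that lattice_pathsD(1,2)[OF assms(2)] skew_shape_sorted(1)[OF assms(1)]
      by (simp add: height_ge_length length_boundary_path count_North_boundary_path)
    then show "k \<in> {..<m + length lam}"
      using k by (fastforce simp: shade_indices_def)
  qed
qed simp

section \<open>Order-preserving maps on a shade as integer sequences\<close>

text \<open>The possible sequences of deficits \<open>d k = t * height x k - S k\<close>. Equivalently, the
  order-preserving maps on the shade lowered by one, read along the vertices of \<open>x\<close> and extended
  by \<open>0\<close> to the vertices that are not the northwest corner of a shade cell.\<close>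

definition shade_labels :: "nat \<Rightarrow> nat list \<Rightarrow> step list \<Rightarrow> nat \<Rightarrow> (nat \<Rightarrow> nat) set" where
  "shade_labels m lam x t = {d. \<forall>k. d k < t \<and> (k \<notin> shade_indices m lam x \<longrightarrow> d k = 0) \<and>
     (height x (Suc k) = height x k \<longrightarrow> d (Suc k) \<le> d k) \<and>
     (height x (Suc k) = Suc (height x k) \<longrightarrow> d k \<le> d (Suc k))}"

lemma height_Suc_cases:
  obtains "height x (Suc k) = height x k" | "height x (Suc k) = Suc (height x k)"
  by (cases "k < length x \<and> x ! k = North") (auto simp: height_Suc)

lemma cover_along_North_step:
  assumes sk: "skew_shape m lam mu" and x: "x \<in> lattice_paths m lam mu"
    and k: "k \<in> shade_indices m lam x" and north: "height x (Suc k) = Suc (height x k)"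
  shows "Suc k \<in> shade_indices m lam x"
    "(corner_cell lam x k, corner_cell lam x (Suc k)) \<in> shade_order lam mu x"
proof -
  show k': "Suc k \<in> shade_indices m lam x"
    using k north height_add_le[of "boundary_path m lam" k 1] by (simp add: shade_indices_def)
  let ?c = "corner_cell lam x k" and ?c' = "corner_cell lam x (Suc k)"
  have shade: "?c \<in> shade lam mu x" "?c' \<in> shade lam mu x"
    using k k' by (auto simp: shade_eq_corner_cells[OF sk x])
  then have "?c \<in> cells lam mu" "?c' \<in> cells lam mu"
    by (auto simp: shade_def path_ideal_def)
  moreover have "?c = (Suc (fst ?c'), snd ?c')"
    using north height_le_count[of x "Suc k"] lattice_pathsD(1)[OF x] height_le[of x k]
    by (simp add: corner_cell_def Suc_diff_Suc)
  ultimately have "(?c, ?c') \<in> cell_covers lam mu"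
    by (cases ?c') (simp add: cell_covers_def)
  then show "(?c, ?c') \<in> shade_order lam mu x"
    using shade \<open>?c \<in> cells lam mu\<close> \<open>?c' \<in> cells lam mu\<close>
    by (simp add: shade_order_def cell_order_def r_into_rtrancl)
qed

lemma cover_along_East_step:
  assumes sk: "skew_shape m lam mu" and x: "x \<in> lattice_paths m lam mu"
    and k: "Suc k \<in> shade_indices m lam x" and east: "height x (Suc k) = height x k"
  shows "k \<in> shade_indices m lam x"
    "(corner_cell lam x (Suc k), corner_cell lam x k) \<in> shade_order lam mu x"
proof -
  show k': "k \<in> shade_indices m lam x"
    using k east height_mono[of k "Suc k" "boundary_path m lam"] by (simp add: shade_indices_def)
  let ?c = "corner_cell lam x (Suc k)" and ?c' = "corner_cell lam x k"
  have shade: "?c \<in> shade lam mu x" "?c' \<in> shade lam mu x"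
    using k k' by (auto simp: shade_eq_corner_cells[OF sk x])
  then have "?c \<in> cells lam mu" "?c' \<in> cells lam mu"
    by (auto simp: shade_def path_ideal_def)
  moreover have "?c = (fst ?c', Suc (snd ?c'))"
    using east height_le[of x k] by (simp add: corner_cell_def Suc_diff_le)
  ultimately have "(?c, ?c') \<in> cell_covers lam mu"
    by (cases ?c') (simp add: cell_covers_def)
  then show "(?c, ?c') \<in> shade_order lam mu x"
    using shade \<open>?c \<in> cells lam mu\<close> \<open>?c' \<in> cells lam mu\<close>
    by (simp add: shade_order_def cell_order_def r_into_rtrancl)
qed

lemma cell_order_northwest:
  assumes "(c, c') \<in> cell_order lam mu"
  shows "fst c' \<le> fst c" "snd c' \<le> snd c"
proof -
  have "(c, c') \<in> (cell_covers lam mu)\<^sup>*"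
    using assms by (simp add: cell_order_def)
  then have "fst c' \<le> fst c \<and> snd c' \<le> snd c"
    by (induction rule: rtrancl_induct) (auto simp: cell_covers_def)
  then show "fst c' \<le> fst c" "snd c' \<le> snd c" by auto
qed

text \<open>Two vertices of a path whose cells are comparable lie in a common row or column, because
  the path goes Northeast and the order Northwest. So the steps between them are all East or all
  North, and the label changes monotonically.\<close>

lemma shade_labels_mono:
  assumes x: "x \<in> lattice_paths m lam mu" and d: "d \<in> shade_labels m lam x t"
    and row: "fst (corner_cell lam x l) \<le> fst (corner_cell lam x k)"
    and col: "snd (corner_cell lam x l) \<le> snd (corner_cell lam x k)"
  shows "d k \<le> d l"
proof -
  have "height x k \<le> height x l"
    using row height_le_count[of x k] height_le_count[of x l] lattice_pathsD(1)[OF x]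
    by (simp add: corner_cell_def)
  have "l - height x l \<le> k - height x k"
    using col by (simp add: corner_cell_def)
  show ?thesis
  proof (cases "l \<le> k")
    case True
    have same_row: "height x i = height x l" if "l \<le> i" "i \<le> k" for i
      using height_mono[OF that(1)] height_mono[OF that(2)] \<open>height x k \<le> height x l\<close>
      by (metis le_antisym le_trans)
    have "i \<le> k \<longrightarrow> d i \<le> d l" if "l \<le> i" for i
      using that
    proof (induction i rule: dec_induct)
      case (step i)
      have "Suc i \<le> k \<longrightarrow> height x (Suc i) = height x i"
        using same_row[of i] same_row[of "Suc i"] step.hyps by simp
      moreover have "height x (Suc i) = height x i \<longrightarrow> d (Suc i) \<le> d i"
        using d by (simp add: shade_labels_def)
      ultimately show ?case
        using step.IH by auto
    qed simp
    then show ?thesis using True by blast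
  next
    case False
    then have "k \<le> l" by simp
    have "height x l - height x k = l - k"
      using \<open>l - height x l \<le> k - height x k\<close> height_add_le[of x k "l - k"]
        height_le[of x k] height_le[of x l] \<open>k \<le> l\<close> by simp
    have same_column: "height x i = height x k + (i - k)" if "k \<le> i" "i \<le> l" for i
      using height_add_le[of x k "i - k"] height_add_le[of x i "l - i"] that
        \<open>height x l - height x k = l - k\<close> \<open>height x k \<le> height x l\<close> by simp
    have "i \<le> l \<longrightarrow> d k \<le> d i" if "k \<le> i" for i
      using that
    proof (induction i rule: dec_induct)
      case (step i)
      have "Suc i \<le> l \<longrightarrow> height x (Suc i) = Suc (height x i)"
        using same_column[of i] same_column[of "Suc i"] step.hyps by (simp add: Suc_diff_le)
      moreover have "height x (Suc i) = Suc (height x i) \<longrightarrow> d i \<le> d (Suc i)"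
        using d by (simp add: shade_labels_def)
      ultimately show ?case
        using step.IH by auto
    qed simp
    then show ?thesis using \<open>k \<le> l\<close> by blast
  qed
qed

lemma bij_betw_order_preserving_maps_shade_labels:
  assumes sk: "skew_shape m lam mu" and x: "x \<in> lattice_paths m lam mu" and "t > 0"
  shows "bij_betw (\<lambda>f k. if k \<in> shade_indices m lam x then f (corner_cell lam x k) - 1 else 0)
    (order_preserving_maps (shade lam mu x) (shade_order lam mu x) t) (shade_labels m lam x t)"
    (is "bij_betw ?to ?F ?D")
proof -
  let ?c = "corner_cell lam x" and ?A = "shade_indices m lam x" and ?P = "shade lam mu x"
  let ?from = "\<lambda>d. restrict (\<lambda>c. d (inv ?c c) + 1) ?P"
  note P = shade_eq_corner_cells[OF sk x]
  have inv: "inv ?c (?c k) = k" for k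
    by (rule inv_f_f[OF inj_corner_cell[OF x]])
  show ?thesis
  proof (rule bij_betwI[where g = ?from])
    show "?to \<in> ?F \<rightarrow> ?D"
    proof
      fix f assume f: "f \<in> ?F"
      have range: "1 \<le> f (?c k) \<and> f (?c k) \<le> t" if "k \<in> ?A" for k
        using f that by (auto simp: order_preserving_maps_def PiE_iff P)
      have mono: "f c \<le> f c'" if "(c, c') \<in> shade_order lam mu x" for c c'
        using f that by (auto simp: order_preserving_maps_def shade_order_def)
      show "?to f \<in> ?D"
        unfolding shade_labels_def
      proof (intro CollectI allI conjI impI)
        fix k
        show "?to f k < t" using range[of k] \<open>t > 0\<close> by auto
        show "?to f k = 0" if "k \<notin> ?A" using that by simp
        show "?to f (Suc k) \<le> ?to f k" if "height x (Suc k) = height x k"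
        proof (cases "Suc k \<in> ?A")
          case True
          note cover = cover_along_East_step[OF sk x True that]
          show ?thesis using mono[OF cover(2)] cover(1) True by (simp add: diff_le_mono)
        qed simp
        show "?to f k \<le> ?to f (Suc k)" if "height x (Suc k) = Suc (height x k)"
        proof (cases "k \<in> ?A")
          case True
          note cover = cover_along_North_step[OF sk x True that]
          show ?thesis using mono[OF cover(2)] cover(1) True by (simp add: diff_le_mono)
        qed simp
      qed
    qed
    show "?from \<in> ?D \<rightarrow> ?F"
    proof
      fix d assume d: "d \<in> ?D"
      then have "d k < t" for k by (simp add: shade_labels_def)
      moreover have "d (inv ?c c) \<le> d (inv ?c c')"
        if "c \<in> ?P" "c' \<in> ?P" "(c, c') \<in> shade_order lam mu x" for c c'
      proof -
        obtain k l where kl: "c = ?c k" "c' = ?c l"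
          using \<open>c \<in> ?P\<close> \<open>c' \<in> ?P\<close> by (auto simp: P)
        have "(c, c') \<in> cell_order lam mu"
          using that(3) by (simp add: shade_order_def)
        then show ?thesis
          using cell_order_northwest[of c c'] unfolding kl inv by (intro shade_labels_mono[OF x d])
      qed
      ultimately show "?from d \<in> ?F"
        by (auto simp: order_preserving_maps_def Suc_le_eq less_Suc_eq_le)
    qed
    show "?from (?to f) = f" if "f \<in> ?F" for f
    proof (rule extensionalityI[of _ ?P])
      fix c assume "c \<in> ?P"
      moreover have "1 \<le> f c"
        using that \<open>c \<in> ?P\<close> by (auto simp: order_preserving_maps_def PiE_iff)
      ultimately show "?from (?to f) c = f c"
        by (auto simp: P inv)
    qed (use that in \<open>auto simp: order_preserving_maps_def PiE_iff\<close>)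
    show "?to (?from d) = d" if "d \<in> ?D" for d
      using that by (auto simp: P inv shade_labels_def)
  qed
qed

text \<open>The sequences \<open>S\<close> with \<open>height x k\<close> the rounded up quotient of \<open>S k\<close> by \<open>t\<close>.\<close>

definition heights_rounding_to :: "nat \<Rightarrow> nat \<Rightarrow> nat list \<Rightarrow> nat list \<Rightarrow> step list \<Rightarrow> (nat \<Rightarrow> nat) set" where
  "heights_rounding_to t m lam mu x = {S \<in> dilated_heights t m lam mu.
     \<forall>k. S k \<le> t * height x k \<and> t * height x k < S k + t}"

text \<open>For \<open>S + d = t * height x\<close> with \<open>0 \<le> d < t\<close>, one of the two bounds on the increment of \<open>S\<close> is
  automatic, and the other one is the monotonicity of \<open>d\<close>. The lower boundary matters only
  where \<open>x\<close> touches it, and there it says \<open>d = 0\<close>.\<close>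

lemma bij_betw_shade_labels_heights:
  assumes x: "x \<in> lattice_paths m lam mu"
  shows "bij_betw (\<lambda>d k. t * height x k - d k) (shade_labels m lam x t)
    (heights_rounding_to t m lam mu x)"
    (is "bij_betw ?g ?D ?S")
proof (rule bij_betwI[where g = ?g])
  let ?L = "height (boundary_path m lam)" and ?U = "height (boundary_path m mu)"
  have le: "d k \<le> t * height x k" if "d \<in> ?D" for d k
  proof (cases "height x k")
    case 0
    then show ?thesis
      using that by (simp add: shade_labels_def shade_indices_def)
  next
    case (Suc h)
    moreover have "d k < t" using that by (simp add: shade_labels_def)
    ultimately show ?thesis by simp
  qed
  show "?g \<in> ?D \<rightarrow> ?S"
  proof
    fix d assume d: "d \<in> ?D"
    define S where "S = ?g d"
    have sum: "S k + d k = t * height x k" for k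
      using le[OF d, of k] by (simp add: S_def)
    have "d k < t" for k
      using d by (simp add: shade_labels_def)
    have "S k \<le> S (Suc k) \<and> S (Suc k) \<le> S k + t" for k
    proof (cases x k rule: height_Suc_cases)
      case 1
      then have "d (Suc k) \<le> d k" using d by (simp add: shade_labels_def)
      then show ?thesis
        using sum[of k] sum[of "Suc k"] 1 \<open>d k < t\<close> by simp
    next
      case 2
      then have "d k \<le> d (Suc k)" using d by (simp add: shade_labels_def)
      then show ?thesis
        using sum[of k] sum[of "Suc k"] 2 \<open>d (Suc k) < t\<close> by simp
    qed
    moreover have "t * ?L k \<le> S k" for k
    proof (cases "k \<in> shade_indices m lam x")
      case True
      then have "t * Suc (?L k) \<le> t * height x k"
        by (intro mult_le_mono2) (simp add: shade_indices_def)
      then show ?thesis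
        using sum[of k] \<open>d k < t\<close> by simp
    next
      case False
      then have "d k = 0" using d by (simp add: shade_labels_def)
      then show ?thesis
        using sum[of k] mult_le_mono2[OF lattice_pathsD(3)[OF x, of k], of t] by linarith
    qed
    moreover have "S k \<le> t * ?U k" for k
      using sum[of k] mult_le_mono2[OF lattice_pathsD(4)[OF x, of k], of t] by linarith
    moreover have "S k \<le> t * height x k \<and> t * height x k < S k + t" for k
      using sum[of k] \<open>d k < t\<close> by simp
    ultimately show "?g d \<in> ?S"
      by (simp add: heights_rounding_to_def dilated_heights_def flip: S_def)
  qed
  show "?g \<in> ?S \<rightarrow> ?D"
  proof
    fix S assume S: "S \<in> ?S"
    define d where "d = ?g S"
    have sum: "d k + S k = t * height x k" and "d k < t" for k
    proof -
      have "S k \<le> t * height x k" "t * height x k < S k + t"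
        using S by (auto simp: heights_rounding_to_def)
      then show "d k + S k = t * height x k" "d k < t"
        unfolding d_def by linarith+
    qed
    have S': "S k \<le> S (Suc k)" "S (Suc k) \<le> S k + t" "t * ?L k \<le> S k" for k
      using S by (auto simp: heights_rounding_to_def dilated_heights_def)
    have "d k = 0" if "k \<notin> shade_indices m lam x" for k
    proof -
      have "?L k = height x k"
        using that lattice_pathsD(3)[OF x, of k] by (simp add: shade_indices_def)
      then show ?thesis
        using sum[of k] S'(3)[of k] by simp
    qed
    moreover have "d (Suc k) \<le> d k" if "height x (Suc k) = height x k" for k
      using sum[of k] sum[of "Suc k"] S'(1)[of k] that by simp
    moreover have "d k \<le> d (Suc k)" if "height x (Suc k) = Suc (height x k)" for k
      using sum[of k] sum[of "Suc k"] S'(2)[of k] that by simp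
    ultimately show "?g S \<in> ?D"
      using \<open>\<And>k. d k < t\<close> by (simp add: shade_labels_def flip: d_def)
  qed
  show "?g (?g d) = d" if "d \<in> ?D" for d
    using le[OF that] by auto
  show "?g (?g S) = S" if "S \<in> ?S" for S
    using that by (auto simp: heights_rounding_to_def)
qed

lemma rounded_heights:
  assumes "S \<in> dilated_heights t m lam mu" "j < t"
  shows "(\<lambda>k. (S k + j) div t) \<in> dilated_heights 1 m lam mu"
proof -
  let ?L = "height (boundary_path m lam)" and ?U = "height (boundary_path m mu)"
  have S: "S k \<le> S (Suc k)" "S (Suc k) \<le> S k + t" "t * ?L k \<le> S k" "S k \<le> t * ?U k" for k
    using assms(1) by (auto simp: dilated_heights_def)
  have "(S k + j) div t \<le> (S (Suc k) + j) div t" for k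
    using S(1) by (intro div_le_mono) simp
  moreover have "(S (Suc k) + j) div t \<le> (S k + j) div t + 1" for k
  proof -
    have "(S (Suc k) + j) div t \<le> (S k + j + t) div t"
      using S(2)[of k] by (intro div_le_mono) simp
    then show ?thesis using assms(2) by simp
  qed
  moreover have "?L k \<le> (S k + j) div t" for k
    using S(3)[of k] assms(2) by (simp add: less_eq_div_iff_mult_less_eq mult.commute)
  moreover have "(S k + j) div t \<le> ?U k" for k
  proof -
    have "(S k + j) div t \<le> (j + t * ?U k) div t"
      using S(4)[of k] by (intro div_le_mono) simp
    then show ?thesis using assms(2) by simp
  qed
  ultimately show ?thesis by (simp add: dilated_heights_def)
qed

lemma dilated_heights_eq_UN:
  assumes "skew_shape m lam mu" "t > 0"
  shows "dilated_heights t m lam mu = (\<Union>x\<in>lattice_paths m lam mu. heights_rounding_to t m lam mu x)"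
proof (intro set_eqI iffI)
  fix S assume S: "S \<in> dilated_heights t m lam mu"
  obtain x where x: "x \<in> lattice_paths m lam mu" "height x = (\<lambda>k. (S k + (t - 1)) div t)"
    using path_with_heights[OF assms(1) rounded_heights[OF S, of "t - 1"]] \<open>t > 0\<close> by auto
  have "S k \<le> t * height x k \<and> t * height x k < S k + t" for k
    using mult_div_mod_eq[of t "S k + (t - 1)"] mod_less_divisor[OF \<open>t > 0\<close>, of "S k + (t - 1)"] \<open>t > 0\<close>
    unfolding x(2) by linarith
  then show "S \<in> (\<Union>x\<in>lattice_paths m lam mu. heights_rounding_to t m lam mu x)"
    using x(1) S by (auto simp: heights_rounding_to_def)
qed (auto simp: heights_rounding_to_def)

lemma heights_rounding_to_disjoint:
  assumes "x \<in> lattice_paths m lam mu" "y \<in> lattice_paths m lam mu" "x \<noteq> y"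
  shows "heights_rounding_to t m lam mu x \<inter> heights_rounding_to t m lam mu y = {}"
proof -
  have le: "height x k \<le> height y k"
    if "S \<in> heights_rounding_to t m lam mu x" "S \<in> heights_rounding_to t m lam mu y" for S x y k
  proof -
    have "t * height x k < S k + t" "S k \<le> t * height y k"
      using that by (auto simp: heights_rounding_to_def)
    then have "t * height x k < t * Suc (height y k)" by simp
    then have "height x k < Suc (height y k)" by (simp only: mult_less_cancel1)
    then show ?thesis by simp
  qed
  have "x = y" if "S \<in> heights_rounding_to t m lam mu x" "S \<in> heights_rounding_to t m lam mu y" for S
    using le[of S x y] le[of S y x] that lattice_pathsD(2)[OF assms(1)] lattice_pathsD(2)[OF assms(2)]
    by (intro height_determines_path) (auto intro: antisym)
  then show ?thesis using assms(3) by blast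
qed

lemma card_dilated_heights:
  assumes sk: "skew_shape m lam mu" and "t > 0"
  shows "card (dilated_heights t m lam mu) =
    (\<Sum>x\<in>lattice_paths m lam mu.
       card (order_preserving_maps (shade lam mu x) (shade_order lam mu x) t))"
proof -
  let ?F = "\<lambda>x. order_preserving_maps (shade lam mu x) (shade_order lam mu x) t"
  let ?S = "heights_rounding_to t m lam mu"
  have bij: "\<exists>f. bij_betw f (?F x) (?S x)" if "x \<in> lattice_paths m lam mu" for x
    using bij_betw_trans[OF bij_betw_order_preserving_maps_shade_labels[OF sk that \<open>t > 0\<close>]
        bij_betw_shade_labels_heights[OF that]] by blast
  have "finite (?F x)" if "x \<in> lattice_paths m lam mu" for x
    using finite_shade_indices[OF sk that]
    by (intro finite_order_preserving_maps) (simp add: shade_eq_corner_cells[OF sk that])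
  then have "card (dilated_heights t m lam mu) = (\<Sum>x\<in>lattice_paths m lam mu. card (?S x))"
    unfolding dilated_heights_eq_UN[OF assms]
    using bij bij_betw_finite heights_rounding_to_disjoint
    by (intro card_UN_disjoint finite_lattice_paths) blast+
  also have "\<dots> = (\<Sum>x\<in>lattice_paths m lam mu. card (?F x))"
    by (intro sum.cong refl) (metis bij bij_betw_same_card)
  finally show ?thesis .
qed

section \<open>Lattice points of the dilated base polytope\<close>

lemma lookup_scaleR: "Poly_Mapping.lookup (c *\<^sub>R v) i = c *\<^sub>R Poly_Mapping.lookup v i"
proof -
  have "finite {i. c *\<^sub>R Poly_Mapping.lookup v i \<noteq> 0}"
    by (rule finite_subset[OF _ finite_lookup[of v]]) auto
  then show ?thesis
    by (simp add: scaleR_poly_mapping_def)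
qed

definition prefix_sum :: "(nat \<Rightarrow>\<^sub>0 real) \<Rightarrow> nat \<Rightarrow> real" where
  "prefix_sum v k = (\<Sum>i<k. Poly_Mapping.lookup v (Suc i))"

lemma linear_lookup: "linear (\<lambda>v :: 'a \<Rightarrow>\<^sub>0 real. Poly_Mapping.lookup v i)"
  by (rule linearI) (simp_all add: lookup_add lookup_scaleR)

lemma linear_prefix_sum: "linear (\<lambda>v. prefix_sum v k)"
  by (rule linearI)
    (simp_all add: prefix_sum_def lookup_add lookup_scaleR sum.distrib sum_distrib_left)

lemma linear_bounds_convex_hull:
  fixes f :: "'a::real_vector \<Rightarrow> real"
  assumes "linear f" "\<And>v. v \<in> B \<Longrightarrow> a \<le> f v \<and> f v \<le> b" "v \<in> convex hull B"
  shows "a \<le> f v \<and> f v \<le> b"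
proof -
  have "convex hull B \<subseteq> f -` {a..b}"
    using assms(2) by (intro hull_minimal convex_linear_vimage[OF assms(1)]) auto
  then show ?thesis using assms(3) by auto
qed

lemma lookup_indicator_vector:
  "finite B \<Longrightarrow> Poly_Mapping.lookup (indicator_vector B) i = (if i \<in> B then 1 else 0)"
  by (simp add: indicator_vector_def lookup_sum lookup_single when_def)

lemma finite_north_positions: "finite (north_positions x)"
  by (simp add: north_positions_def)

lemma prefix_sum_indicator_vector:
  "prefix_sum (indicator_vector (north_positions x)) k = real (height x k)"
proof -
  have "Suc k \<in> north_positions x \<longleftrightarrow> k < length x \<and> x ! k = North" for k
    by (auto simp: north_positions_def)
  then show ?thesis
    unfolding prefix_sum_def
    by (induction k) (simp_all add: lookup_indicator_vector[OF finite_north_positions] height_Suc)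
qed

text \<open>Shifting \<open>s\<close> by one replaces the term \<open>s div t\<close> by \<open>(s + t) div t\<close>.\<close>

lemma sum_shifted_div:
  fixes s t :: nat
  assumes "t > 0"
  shows "(\<Sum>j<t. (s + j) div t) = s"
proof (induction s)
  case (Suc s)
  have "s div t + (\<Sum>j<t. (Suc s + j) div t) = (\<Sum>j<Suc t. (s + j) div t)"
    by (subst sum.lessThan_Suc_shift) simp
  also have "\<dots> = s + (s div t + 1)"
    using Suc assms by simp
  finally show ?case by simp
qed (simp add: assms)

lemma lattice_points_bounds:
  assumes v: "v \<in> lattice_points ((\<lambda>v. real t *\<^sub>R v) ` base_polytope (lattice_path_matroid m lam mu))"
  shows "Poly_Mapping.lookup v 0 = 0"
    and "0 \<le> Poly_Mapping.lookup v i" "Poly_Mapping.lookup v i \<le> real t"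
    and "real (t * height (boundary_path m lam) k) \<le> prefix_sum v k"
    and "prefix_sum v k \<le> real (t * height (boundary_path m mu) k)"
    and "prefix_sum v k \<in> \<int>"
proof -
  let ?B = "indicator_vector ` north_positions ` lattice_paths m lam mu"
  obtain w where w: "w \<in> convex hull ?B" and vw: "v = real t *\<^sub>R w"
    using v by (auto simp: lattice_points_def base_polytope_def lattice_path_matroid_def)
  have "0 \<le> Poly_Mapping.lookup w 0 \<and> Poly_Mapping.lookup w 0 \<le> 0"
  proof (rule linear_bounds_convex_hull[OF linear_lookup _ w])
    have "0 \<notin> north_positions x" for x
      by (simp add: north_positions_def)
    then show "0 \<le> Poly_Mapping.lookup b 0 \<and> Poly_Mapping.lookup b 0 \<le> 0" if "b \<in> ?B" for b
      using that by (auto simp: lookup_indicator_vector[OF finite_north_positions])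
  qed
  then show "Poly_Mapping.lookup v 0 = 0"
    by (simp add: vw lookup_scaleR)
  have "0 \<le> Poly_Mapping.lookup w i \<and> Poly_Mapping.lookup w i \<le> 1"
    by (rule linear_bounds_convex_hull[OF linear_lookup _ w])
      (auto simp: lookup_indicator_vector[OF finite_north_positions])
  then show "0 \<le> Poly_Mapping.lookup v i" "Poly_Mapping.lookup v i \<le> real t"
    by (simp_all add: vw lookup_scaleR mult_left_le)
  have "real (height (boundary_path m lam) k) \<le> prefix_sum w k \<and>
      prefix_sum w k \<le> real (height (boundary_path m mu) k)"
    by (rule linear_bounds_convex_hull[OF linear_prefix_sum _ w])
      (auto simp: prefix_sum_indicator_vector lattice_pathsD)
  moreover have "prefix_sum v k = real t * prefix_sum w k"
    by (simp add: vw linear_cmul[OF linear_prefix_sum])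
  ultimately show "real (t * height (boundary_path m lam) k) \<le> prefix_sum v k"
    "prefix_sum v k \<le> real (t * height (boundary_path m mu) k)"
    by (simp_all add: mult_left_mono)
  show "prefix_sum v k \<in> \<int>"
    using v by (auto simp: prefix_sum_def lattice_points_def)
qed

text \<open>Hermite's identity
  \<open>S k = (\<Sum>j<t. (S k + j) div t)\<close> writes \<open>S\<close> as the sum of the height functions of \<open>t\<close> lattice
  paths, so the sum of the \<open>t\<close> corresponding vertices of the base polytope has the prefix sums \<open>S\<close>.\<close>

lemma dilated_heights_attained:
  assumes sk: "skew_shape m lam mu" and "t > 0" and S: "S \<in> dilated_heights t m lam mu"
  obtains v where
    "v \<in> lattice_points ((\<lambda>v. real t *\<^sub>R v) ` base_polytope (lattice_path_matroid m lam mu))"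
    "\<And>k. prefix_sum v k = real (S k)"
proof -
  have "\<exists>x. j < t \<longrightarrow> x \<in> lattice_paths m lam mu \<and> height x = (\<lambda>k. (S k + j) div t)" for j
    using path_with_heights[OF sk rounded_heights[OF S]] by metis
  then obtain x where x: "\<And>j. j < t \<Longrightarrow> x j \<in> lattice_paths m lam mu"
      "\<And>j k. j < t \<Longrightarrow> height (x j) k = (S k + j) div t"
    by metis
  let ?e = "\<lambda>j. indicator_vector (north_positions (x j))"
  define v where "v = (\<Sum>j<t. ?e j)"
  have "(\<Sum>j<t. (1 / real t) *\<^sub>R ?e j) \<in> base_polytope (lattice_path_matroid m lam mu)"
    unfolding base_polytope_def using x(1) \<open>t > 0\<close>
    by (intro convex_sum convex_convex_hull hull_inc) (auto simp: lattice_path_matroid_def)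
  moreover have "v = real t *\<^sub>R (\<Sum>j<t. (1 / real t) *\<^sub>R ?e j)"
    using \<open>t > 0\<close> by (simp add: v_def flip: scaleR_sum_right)
  moreover have "Poly_Mapping.lookup v i \<in> \<int>" for i
    by (auto simp: v_def lookup_sum lookup_indicator_vector[OF finite_north_positions])
  ultimately have
    "v \<in> lattice_points ((\<lambda>v. real t *\<^sub>R v) ` base_polytope (lattice_path_matroid m lam mu))"
    by (auto simp: lattice_points_def)
  moreover have "prefix_sum v k = real (S k)" for k
  proof -
    have "prefix_sum v k = (\<Sum>j<t. prefix_sum (?e j) k)"
      by (simp add: v_def linear_sum[OF linear_prefix_sum])
    also have "\<dots> = real (\<Sum>j<t. (S k + j) div t)"
      by (simp add: prefix_sum_indicator_vector x(2))
    finally show ?thesis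
      by (simp add: sum_shifted_div[OF \<open>t > 0\<close>])
  qed
  ultimately show ?thesis by (rule that)
qed

lemma bij_betw_lattice_points_heights:
  assumes sk: "skew_shape m lam mu" and "t > 0"
  shows "bij_betw (\<lambda>v k. nat \<lfloor>prefix_sum v k\<rfloor>)
    (lattice_points ((\<lambda>v. real t *\<^sub>R v) ` base_polytope (lattice_path_matroid m lam mu)))
    (dilated_heights t m lam mu)"
    (is "bij_betw ?S ?V _")
proof (rule bij_betw_imageI)
  have S: "real (?S v k) = prefix_sum v k" if "v \<in> ?V" for v k
  proof -
    have "0 \<le> prefix_sum v k"
      using lattice_points_bounds(4)[OF that, of k] of_nat_0_le_iff order.trans by blast
    moreover have "prefix_sum v k \<in> \<int>"
      by (rule lattice_points_bounds(6)[OF that])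
    ultimately show ?thesis by (auto elim: Ints_cases)
  qed
  have Suc: "prefix_sum v (Suc k) = prefix_sum v k + Poly_Mapping.lookup v (Suc k)" for v k
    by (simp add: prefix_sum_def)
  show "inj_on ?S ?V"
  proof (rule inj_onI)
    fix v w assume v: "v \<in> ?V" and w: "w \<in> ?V" and "?S v = ?S w"
    then have eq: "prefix_sum v k = prefix_sum w k" for k
      by (metis S)
    show "v = w"
    proof (rule poly_mapping_eqI)
      fix i
      show "Poly_Mapping.lookup v i = Poly_Mapping.lookup w i"
      proof (cases i)
        case 0
        then show ?thesis
          using lattice_points_bounds(1)[OF v] lattice_points_bounds(1)[OF w] by simp
      next
        case (Suc k)
        then show ?thesis
          using eq[of k] eq[of "Suc k"] by (simp add: \<open>\<And>v k. prefix_sum v (Suc k) = _\<close>)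
      qed
    qed
  qed
  show "?S ` ?V = dilated_heights t m lam mu"
  proof (intro set_eqI iffI)
    fix S assume "S \<in> ?S ` ?V"
    then obtain v where v: "v \<in> ?V" "S = ?S v" by blast
    have Sv: "real (S k) = prefix_sum v k" for k
      using S[OF v(1)] v(2) by simp
    have "S k \<le> S (Suc k) \<and> S (Suc k) \<le> S k + t \<and>
        t * height (boundary_path m lam) k \<le> S k \<and> S k \<le> t * height (boundary_path m mu) k" for k
    proof -
      have "real (S k) \<le> real (S (Suc k))" "real (S (Suc k)) \<le> real (S k + t)"
        using lattice_points_bounds(2,3)[OF v(1), of "Suc k"]
        by (simp_all add: Sv Suc)
      moreover have "real (t * height (boundary_path m lam) k) \<le> real (S k)"
          "real (S k) \<le> real (t * height (boundary_path m mu) k)"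
        using lattice_points_bounds(4,5)[OF v(1), of k] by (simp_all only: Sv)
      ultimately show ?thesis by (simp only: of_nat_le_iff)
    qed
    then show "S \<in> dilated_heights t m lam mu"
      by (simp add: dilated_heights_def)
  next
    fix S assume "S \<in> dilated_heights t m lam mu"
    then obtain v where v: "v \<in> ?V" "\<And>k. prefix_sum v k = real (S k)"
      using dilated_heights_attained[OF sk \<open>t > 0\<close>] by blast
    then have "?S v = S" by auto
    then show "S \<in> ?S ` ?V" using v(1) by blast
  qed
qed

theorem proposition6p5:
  fixes m :: nat and lam mu :: "nat list"
  assumes "skew_shape m lam mu"
  shows "matroid_ehrhart (lattice_path_matroid m lam mu) =
    (\<Sum>x\<in>lattice_paths m lam mu. order_polynomial (shade lam mu x) (shade_order lam mu x))"
proof -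
  let ?Q = "base_polytope (lattice_path_matroid m lam mu)"
  let ?p = "\<Sum>x\<in>lattice_paths m lam mu. order_polynomial (shade lam mu x) (shade_order lam mu x)"
  have count: "poly ?p (of_nat t) = of_nat (card (lattice_points ((\<lambda>v. real t *\<^sub>R v) ` ?Q)))"
    if "t > 0" for t
  proof -
    have "finite (shade lam mu x)" if "x \<in> lattice_paths m lam mu" for x
      using finite_shade_indices[OF assms that] by (simp add: shade_eq_corner_cells[OF assms that])
    then have "poly ?p (of_nat t) = of_nat (\<Sum>x\<in>lattice_paths m lam mu.
        card (order_preserving_maps (shade lam mu x) (shade_order lam mu x) t))"
      using \<open>t > 0\<close> by (simp add: poly_sum poly_order_polynomial)
    also have "\<dots> = of_nat (card (dilated_heights t m lam mu))"
      by (simp add: card_dilated_heights[OF assms that])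
    also have "card (dilated_heights t m lam mu) = card (lattice_points ((\<lambda>v. real t *\<^sub>R v) ` ?Q))"
      using bij_betw_lattice_points_heights[OF assms that] by (simp add: bij_betw_same_card)
    finally show ?thesis .
  qed
  show ?thesis
    unfolding matroid_ehrhart_def ehrhart_polynomial_def
  proof (rule the_equality)
    fix q :: "rat poly"
    assume "\<forall>t::nat. t > 0 \<longrightarrow>
      poly q (of_nat t) = of_nat (card (lattice_points ((\<lambda>v. real t *\<^sub>R v) ` ?Q)))"
    then show "q = ?p"
      by (intro rat_poly_eqI_pos_nat) (simp add: count)
  qed (simp add: count)
qed

end
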